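(* Let $A=(a(j,j'))_{j,j'\in\mathbb{Z}}$ be an infinite matrix with the property that $\sum_{k\in\mathbb{Z}}\sup_{j\in\mathbb{Z}}|a(j,j+k)|<\infty$. If $A$ has $\ell^p$-stability for some $1\le p\le\infty$, then $A$ has $\ell^q$-stability for all $1\le q\le\infty$.
   Context: For $1\le p\le\infty$, $\ell^p$ is the space of $p$-summable sequences $c=(c(j))_{j\in\mathbb{Z}}$ with the standard norm $\|\cdot\|_{\ell^p}$. The matrix $A$ acts on $\ell^p$ by $(Ac)(j)=\sum_{j'\in\mathbb{Z}}a(j,j')c(j')$, $j\in\mathbb{Z}$. An operator $A$ on $\ell^p$ has $\ell^p$-stability if there exists a positive constant $C$ such that $C^{-1}\|c\|_{\ell^p}\le\|Ac\|_{\ell^p}\le C\|c\|_{\ell^p}$ for all $c\in\ell^p$. *)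

theory Defs
  imports "HOL-Analysis.Analysis"
begin

definition lp_space :: "ereal \<Rightarrow> (int \<Rightarrow> complex) set" where
  "lp_space p =
     (if p = \<infinity> then {c. bdd_above (range (\<lambda>j. norm (c j)))}
      else {c. (\<lambda>j. norm (c j) powr real_of_ereal p) summable_on UNIV})"

text \<open>Both \<open>lp_space\<close> and \<open>lp_norm\<close> are meant for \<open>1 \<le> p \<le> \<infinity>\<close>. The norm is real-valued, so it
  is meaningful only for sequences in \<open>lp_space p\<close>; elsewhere it takes arbitrary default values.\<close>

definition lp_norm :: "ereal \<Rightarrow> (int \<Rightarrow> complex) \<Rightarrow> real" where
  "lp_norm p c =
     (if p = \<infinity> then (SUP j. norm (c j))
      else (\<Sum>\<^sub>\<infinity>j. norm (c j) powr real_of_ereal p) powr (1 / real_of_ereal p))"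

text \<open>If the suprema of \<open>\<bar>a j (j + k)\<bar>\<close> over \<open>j\<close> are summable in \<open>k\<close>, the series below converges
  absolutely for every \<open>c\<close> in every \<open>lp_space p\<close> with \<open>1 \<le> p\<close>, so the default value \<open>0\<close> of
  \<open>infsum\<close> for divergent sums plays no role.\<close>

definition matrix_op :: "(int \<Rightarrow> int \<Rightarrow> complex) \<Rightarrow> (int \<Rightarrow> complex) \<Rightarrow> int \<Rightarrow> complex" where
  "matrix_op a c j = (\<Sum>\<^sub>\<infinity>j'. a j j' * c j')"

text \<open>The condition \<open>T c \<in> lp_space p\<close> says that \<open>T\<close> is an operator on the sequence space; with the
  real-valued norm it is not implied by the upper bound.\<close>

definition lp_stable :: "ereal \<Rightarrow> ((int \<Rightarrow> complex) \<Rightarrow> int \<Rightarrow> complex) \<Rightarrow> bool" where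
  "lp_stable p T \<longleftrightarrow>
     (\<forall>c\<in>lp_space p. T c \<in> lp_space p) \<and>
     (\<exists>C>0. \<forall>c\<in>lp_space p.
        inverse C * lp_norm p c \<le> lp_norm p (T c) \<and> lp_norm p (T c) \<le> C * lp_norm p c)"

end

theory Submission
  imports Defs
begin

text \<open>Localise with the windows \<open>h\<^sub>m(j) = max 0 (1 - \<bar>j - m\<bar> / N)\<close>, one for every integer \<open>m\<close>, always
  measuring the localised pieces in the norm with the exponent \<open>p\<close> of the hypothesis: put
  \<open>u(m) = \<parallel>h\<^sub>m c\<parallel>\<^sub>p\<close> and \<open>v(m) = \<parallel>h\<^sub>m A c\<parallel>\<^sub>p\<close>, and let \<open>s(k)\<close> be the supremum of \<open>\<bar>a(j, j + k)\<bar>\<close> over \<open>j\<close>.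
  Estimating the commutator of \<open>A\<close> with \<open>h\<^sub>m\<close> turns the lower bound with constant \<open>C\<close> into
  \<open>u(m) \<le> C v(m) + C (\<Sum>k. s(k) min(1, \<bar>k\<bar>/N) (\<Sum>\<bar>i\<bar>\<le>2. u(m + i N) + u(m + k)))\<close>.
  The total mass of this convolution kernel tends to 0 as \<open>N\<close> grows. Hence for large \<open>N\<close> the second term
  is absorbed after taking the norm with exponent \<open>q\<close> over \<open>m\<close>, and
  \<open>\<parallel>c\<parallel>\<^sub>q \<le> \<parallel>u\<parallel>\<^sub>q \<le> 2 C \<parallel>v\<parallel>\<^sub>q \<le> 2 C (2 N + 1) \<parallel>A c\<parallel>\<^sub>q\<close>. The factor \<open>2 N + 1\<close> is harmless because
  \<open>N\<close> depends only on \<open>C\<close> and \<open>s\<close>.\<close>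

section \<open>Norm bounds in sequence spaces\<close>

text \<open>The relation is phrased with finite partial sums, so that it is closed under pointwise limits and
  makes sense without any summability assumption.\<close>

definition lp_bound :: "ereal \<Rightarrow> (int \<Rightarrow> real) \<Rightarrow> real \<Rightarrow> bool" where
  "lp_bound p f t \<longleftrightarrow> 0 \<le> t \<and>
     (if p = \<infinity> then \<forall>j. \<bar>f j\<bar> \<le> t
      else \<forall>F. finite F \<longrightarrow> (\<Sum>j\<in>F. \<bar>f j\<bar> powr real_of_ereal p) \<le> t powr real_of_ereal p)"

lemma lp_bound_infinity: "lp_bound \<infinity> f t \<longleftrightarrow> (\<forall>j. \<bar>f j\<bar> \<le> t)"
  unfolding lp_bound_def using abs_ge_zero order_trans by auto

lemma lp_bound_ereal:
  "lp_bound (ereal r) f t \<longleftrightarrow>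
     0 \<le> t \<and> (\<forall>F. finite F \<longrightarrow> (\<Sum>j\<in>F. \<bar>f j\<bar> powr r) \<le> t powr r)"
  unfolding lp_bound_def by simp

lemma exponent_cases:
  fixes p :: ereal
  assumes "1 \<le> p"
  obtains (finite) r where "p = ereal r" "1 \<le> r" | (infinite) "p = \<infinity>"
  using assms by (cases p) auto

lemma lp_bound_nonneg: "lp_bound p f t \<Longrightarrow> 0 \<le> t"
  by (simp add: lp_bound_def)

lemma powr_le_cancel:
  fixes x y r :: real
  assumes "x powr r \<le> y powr r" "0 \<le> y" "0 < r"
  shows "x \<le> y"
  using assms by (meson linorder_not_less powr_less_mono2)

lemma lp_bound_point:
  assumes "1 \<le> p" "lp_bound p f t"
  shows "\<bar>f j\<bar> \<le> t"
  using assms(1)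
proof (cases rule: exponent_cases)
  case (finite r)
  then have "(\<Sum>j\<in>{j}. \<bar>f j\<bar> powr r) \<le> t powr r" "0 \<le> t"
    using assms(2) lp_bound_ereal by blast+
  then show ?thesis
    using finite powr_le_cancel[of "\<bar>f j\<bar>" r t] by simp
next
  case infinite
  then show ?thesis using assms(2) by (simp add: lp_bound_infinity)
qed

lemma lp_bound_mono:
  assumes "1 \<le> p" "lp_bound p f s" "\<And>j. \<bar>g j\<bar> \<le> \<bar>f j\<bar>" "s \<le> t"
  shows "lp_bound p g t"
  using assms(1)
proof (cases rule: exponent_cases)
  case (finite r)
  have "0 \<le> s" using assms(2) by (rule lp_bound_nonneg)
  have "(\<Sum>j\<in>F. \<bar>g j\<bar> powr r) \<le> t powr r" if "finite F" for F
  proof -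
    have "(\<Sum>j\<in>F. \<bar>g j\<bar> powr r) \<le> (\<Sum>j\<in>F. \<bar>f j\<bar> powr r)"
      using finite assms(3) by (intro sum_mono powr_mono2) auto
    also have "\<dots> \<le> s powr r"
      using assms(2) that by (simp add: finite lp_bound_ereal)
    also have "\<dots> \<le> t powr r"
      using finite \<open>0 \<le> s\<close> assms(4) by (intro powr_mono2) auto
    finally show ?thesis .
  qed
  then show ?thesis using \<open>0 \<le> s\<close> assms(4) by (simp add: finite lp_bound_ereal)
next
  case infinite
  have "\<bar>f j\<bar> \<le> s" for j
    using assms(2) by (simp add: infinite lp_bound_infinity)
  then show ?thesis using assms(3,4) unfolding infinite lp_bound_infinity
    by (meson order_trans)
qed

lemma lp_bound_zero: "1 \<le> p \<Longrightarrow> lp_bound p (\<lambda>j. 0) 0"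
  by (simp add: lp_bound_def)

lemma lp_bound_scale:
  assumes "1 \<le> p" "lp_bound p f t" "0 \<le> a"
  shows "lp_bound p (\<lambda>j. a * f j) (a * t)"
  using assms(1)
proof (cases rule: exponent_cases)
  case (finite r)
  have "0 \<le> t" using assms(2) by (rule lp_bound_nonneg)
  have "(\<Sum>j\<in>F. \<bar>a * f j\<bar> powr r) \<le> (a * t) powr r" if "finite F" for F
  proof -
    have "(\<Sum>j\<in>F. \<bar>a * f j\<bar> powr r) = a powr r * (\<Sum>j\<in>F. \<bar>f j\<bar> powr r)"
      using assms(3) by (simp add: abs_mult powr_mult sum_distrib_left)
    also have "\<dots> \<le> a powr r * t powr r"
      using assms(2) that by (intro mult_left_mono) (auto simp: finite lp_bound_ereal)
    finally show ?thesis using assms(3) \<open>0 \<le> t\<close> by (simp add: powr_mult)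
  qed
  then show ?thesis using \<open>0 \<le> t\<close> assms(3) by (simp add: finite lp_bound_ereal)
next
  case infinite
  then show ?thesis using assms(2,3)
    by (simp add: lp_bound_infinity abs_mult mult_left_mono)
qed

section \<open>Minkowski's inequality and its limiting forms\<close>

lemma powr_convex_combination:
  fixes x y a b r :: real
  assumes "1 \<le> r" "0 \<le> x" "0 \<le> y" "0 < a" "0 < b" "a + b = 1"
  shows "(a * x + b * y) powr r \<le> a * x powr r + b * y powr r"
proof -
  \<comment> \<open>Convexity is invoked on the open half-line only. If one argument is 0, a single
    term remains, and \<open>c powr r \<le> c\<close> for \<open>c\<close> in (0, 1]
    suffices.\<close>
  have edge: "(c * z) powr r \<le> c * z powr r" if "0 < c" "c \<le> 1" "0 \<le> z" for c z :: real
  proof -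
    have "c powr r \<le> c powr 1"
      using that assms(1) by (intro powr_mono') auto
    then show ?thesis using that by (simp add: powr_mult mult_right_mono)
  qed
  show ?thesis
  proof (cases "x = 0 \<or> y = 0")
    case True
    then show ?thesis using edge[of a x] edge[of b y] assms by auto
  next
    case False
    then have xy: "x \<in> {0<..}" "y \<in> {0<..}" using assms by auto
    have "a = 1 - b" "0 \<le> b" "b \<le> 1" using assms by auto
    then show ?thesis
      using convex_onD[OF powr_convex[OF assms(1)] _ _ xy, of b] by simp
  qed
qed

text \<open>Minkowski's inequality by normalisation: \<open>f / s\<close> and \<open>g / t\<close>
  have bound 1, and the absolute value of \<open>(f + g) / (s + t)\<close> is at most the convex
  combination of theirs with weights \<open>s / (s + t)\<close> and \<open>t / (s + t)\<close>.
  Positive bounds make the divisions legitimate.\<close>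

lemma lp_bound_add_pos:
  assumes "1 \<le> p" "lp_bound p f s" "lp_bound p g t" "0 < s" "0 < t"
  shows "lp_bound p (\<lambda>j. f j + g j) (s + t)"
  using assms(1)
proof (cases rule: exponent_cases)
  case (finite r)
  define a b where "a = s / (s + t)" and "b = t / (s + t)"
  have ab: "0 < a" "0 < b" "a + b = 1"
    using assms(4,5) by (auto simp: a_def b_def add_divide_distrib[symmetric])
  have point: "\<bar>f j + g j\<bar> powr r
      \<le> (s + t) powr r * (a * (\<bar>f j\<bar> powr r / s powr r) + b * (\<bar>g j\<bar> powr r / t powr r))" for j
  proof -
    have "\<bar>f j + g j\<bar> powr r \<le> ((s + t) * (a * (\<bar>f j\<bar> / s) + b * (\<bar>g j\<bar> / t))) powr r"
      using assms(4,5) finite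
      by (intro powr_mono2) (auto simp: a_def b_def distrib_left)
    also have "\<dots> = (s + t) powr r * (a * (\<bar>f j\<bar> / s) + b * (\<bar>g j\<bar> / t)) powr r"
      using assms(4,5) ab by (simp add: powr_mult)
    also have "\<dots> \<le> (s + t) powr r * (a * (\<bar>f j\<bar> / s) powr r + b * (\<bar>g j\<bar> / t) powr r)"
      using assms(4,5) ab finite by (intro mult_left_mono powr_convex_combination) auto
    finally show ?thesis using assms(4,5) by (simp add: powr_divide)
  qed
  have "(\<Sum>j\<in>F. \<bar>f j + g j\<bar> powr r) \<le> (s + t) powr r" if "finite F" for F
  proof -
    have *: "(\<Sum>j\<in>F. \<bar>f j\<bar> powr r) / s powr r \<le> 1" "(\<Sum>j\<in>F. \<bar>g j\<bar> powr r) / t powr r \<le> 1"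
      using assms(2-5) that by (auto simp: finite lp_bound_ereal)
    have "(\<Sum>j\<in>F. \<bar>f j + g j\<bar> powr r)
        \<le> (\<Sum>j\<in>F. (s + t) powr r * (a * (\<bar>f j\<bar> powr r / s powr r) + b * (\<bar>g j\<bar> powr r / t powr r)))"
      by (intro sum_mono point)
    also have "\<dots> = (s + t) powr r * (a * ((\<Sum>j\<in>F. \<bar>f j\<bar> powr r) / s powr r)
        + b * ((\<Sum>j\<in>F. \<bar>g j\<bar> powr r) / t powr r))"
      by (simp add: sum_distrib_left sum.distrib sum_divide_distrib distrib_left)
    also have "\<dots> \<le> (s + t) powr r * (a * 1 + b * 1)"
      using ab * by (intro mult_left_mono add_mono) auto
    finally show ?thesis using ab by simp
  qed
  then show ?thesis using assms(4,5) by (simp add: finite lp_bound_ereal)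
next
  case infinite
  have "\<bar>f j\<bar> \<le> s" "\<bar>g j\<bar> \<le> t" for j
    using assms(2,3) by (simp_all add: infinite lp_bound_infinity)
  then show ?thesis unfolding infinite lp_bound_infinity
    by (meson abs_triangle_ineq add_mono order_trans)
qed

text \<open>A partial sum depends continuously on finitely many coordinates, so its inequality
  survives a limit. The filter is arbitrary in order to cover both bounds decreasing to a degenerate
  value and finite sets exhausting an index set.\<close>

lemma lp_bound_limit:
  assumes "1 \<le> p" "\<And>x. x \<in> X \<Longrightarrow> lp_bound p (f x) (t x)" "eventually (\<lambda>x. x \<in> X) L" "L \<noteq> bot"
    "\<And>j. ((\<lambda>x. f x j) \<longlongrightarrow> g j) L" "(t \<longlongrightarrow> u) L"
  shows "lp_bound p g u"
proof -
  have u: "0 \<le> u"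
    using assms(3,4,6) lp_bound_nonneg[OF assms(2)]
    by (intro tendsto_lowerbound[of t u L]) (auto elim: eventually_mono)
  show ?thesis
    using assms(1)
  proof (cases rule: exponent_cases)
    case (finite r)
    \<comment> \<open>The limit may be 0, where continuity of the power relies on a positive
      exponent and on eventually nonnegative bases.\<close>
    have pow: "((\<lambda>x. h x powr r) \<longlongrightarrow> l powr r) L"
      if "(h \<longlongrightarrow> l) L" "eventually (\<lambda>x. 0 \<le> h x) L" for h :: "_ \<Rightarrow> real" and l
      using that finite by (intro tendsto_powr') auto
    have "(\<Sum>j\<in>F. \<bar>g j\<bar> powr r) \<le> u powr r" if "finite F" for F
    proof (rule tendsto_le[OF assms(4)])
      show "((\<lambda>x. t x powr r) \<longlongrightarrow> u powr r) L"
        using assms(6) eventually_mono[OF assms(3) lp_bound_nonneg[OF assms(2)]] by (rule pow)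
      show "((\<lambda>x. \<Sum>j\<in>F. \<bar>f x j\<bar> powr r) \<longlongrightarrow> (\<Sum>j\<in>F. \<bar>g j\<bar> powr r)) L"
        by (intro tendsto_sum pow tendsto_rabs assms(5)) auto
      show "\<forall>\<^sub>F x in L. (\<Sum>j\<in>F. \<bar>f x j\<bar> powr r) \<le> t x powr r"
        using assms(3) by eventually_elim (use assms(2) that in \<open>auto simp: finite lp_bound_ereal\<close>)
    qed
    then show ?thesis using u by (simp add: finite lp_bound_ereal)
  next
    case infinite
    have "\<bar>g j\<bar> \<le> u" for j
    proof (rule tendsto_le[OF assms(4,6) tendsto_rabs[OF assms(5)]])
      show "\<forall>\<^sub>F x in L. \<bar>f x j\<bar> \<le> t x"
        using assms(3) by eventually_elim (use assms(2) infinite in \<open>auto simp: lp_bound_infinity\<close>)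
    qed
    then show ?thesis by (simp add: infinite lp_bound_infinity)
  qed
qed

text \<open>Bounds equal to 0 are reached by enlarging both bounds by \<open>e\<close> and letting
  \<open>e\<close> tend to 0 from the right.\<close>

lemma lp_bound_add:
  assumes "1 \<le> p" "lp_bound p f s" "lp_bound p g t"
  shows "lp_bound p (\<lambda>j. f j + g j) (s + t)"
proof (rule lp_bound_limit[where X = "{0<..}" and L = "at_right (0 :: real)"
      and f = "\<lambda>_ j. f j + g j" and t = "\<lambda>e. (s + e) + (t + e)"])
  show "lp_bound p (\<lambda>j. f j + g j) ((s + e) + (t + e))" if "e \<in> {0<..}" for e
    using that assms lp_bound_nonneg[OF assms(2)] lp_bound_nonneg[OF assms(3)]
    by (intro lp_bound_add_pos lp_bound_mono[OF assms(1,2)] lp_bound_mono[OF assms(1,3)]) auto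
  show "((\<lambda>e. (s + e) + (t + e)) \<longlongrightarrow> s + t) (at_right 0)"
    by (auto intro!: tendsto_eq_intros)
qed (use assms in \<open>auto simp: eventually_at_right_less\<close>)

lemma lp_bound_sum:
  assumes "1 \<le> p" "finite K" "\<And>k. k \<in> K \<Longrightarrow> lp_bound p (f k) (t k)"
  shows "lp_bound p (\<lambda>j. \<Sum>k\<in>K. f k j) (\<Sum>k\<in>K. t k)"
  using assms(2,3)
  by (induction K rule: finite_induct) (simp_all add: lp_bound_zero lp_bound_add assms(1))

text \<open>Minkowski's inequality for infinitely many summands, used later to sum a matrix over its
  diagonals. The summability hypotheses make each \<open>infsum\<close> the limit of its finite
  partial sums.\<close>

lemma lp_bound_infsum:
  assumes "1 \<le> p" "\<And>k. k \<in> K \<Longrightarrow> lp_bound p (f k) (t k)"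
    "\<And>j. (\<lambda>k. f k j) summable_on K" "t summable_on K"
  shows "lp_bound p (\<lambda>j. \<Sum>\<^sub>\<infinity>k\<in>K. f k j) (\<Sum>\<^sub>\<infinity>k\<in>K. t k)"
proof (rule lp_bound_limit[where X = "{F. finite F \<and> F \<subseteq> K}" and L = "finite_subsets_at_top K"
      and f = "\<lambda>F j. \<Sum>k\<in>F. f k j" and t = "\<lambda>F. \<Sum>k\<in>F. t k"])
  show "lp_bound p (\<lambda>j. \<Sum>k\<in>F. f k j) (\<Sum>k\<in>F. t k)" if "F \<in> {F. finite F \<and> F \<subseteq> K}" for F
    using that assms(1,2) by (intro lp_bound_sum) auto
qed (use assms in \<open>auto intro: infsum_tendsto\<close>)

lemma lp_bound_shift:
  assumes "1 \<le> p" "lp_bound p f t"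
  shows "lp_bound p (\<lambda>j. f (j + k)) t"
  using assms(1)
proof (cases rule: exponent_cases)
  case (finite r)
  have "(\<Sum>j\<in>F. \<bar>f (j + k)\<bar> powr r) = (\<Sum>j\<in>(\<lambda>j. j + k) ` F. \<bar>f j\<bar> powr r)" for F
    by (simp add: sum.reindex)
  then show ?thesis using assms(2) by (simp add: finite lp_bound_ereal)
next
  case infinite
  then show ?thesis using assms(2) by (simp add: lp_bound_infinity)
qed

lemma lp_bound_single:
  assumes "1 \<le> p"
  shows "lp_bound p (\<lambda>j. if j = i then x else 0) \<bar>x\<bar>"
  using assms
proof (cases rule: exponent_cases)
  case (finite r)
  have "(\<Sum>j\<in>F. \<bar>if j = i then x else 0\<bar> powr r) \<le> \<bar>x\<bar> powr r" if "finite F" for F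
  proof -
    have "(\<Sum>j\<in>F. \<bar>if j = i then x else 0\<bar> powr r) = (\<Sum>j\<in>F. if j = i then \<bar>x\<bar> powr r else 0)"
      by (rule sum.cong) auto
    then show ?thesis using that by (simp add: sum.delta)
  qed
  then show ?thesis by (simp add: finite lp_bound_ereal)
qed (simp add: lp_bound_infinity)

section \<open>Translation between \<open>lp_bound\<close> and the sequence spaces with their
  norms\<close>

lemma lp_space_iff_bound:
  assumes "1 \<le> p"
  shows "c \<in> lp_space p \<longleftrightarrow> (\<exists>t. lp_bound p (\<lambda>j. norm (c j)) t)"
  using assms
proof (cases rule: exponent_cases)
  case (finite r)
  show ?thesis
  proof
    assume "c \<in> lp_space p"
    then have sm: "(\<lambda>j. norm (c j) powr r) summable_on UNIV" by (simp add: lp_space_def finite)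
    define S where "S = (\<Sum>\<^sub>\<infinity>j. norm (c j) powr r)"
    have "0 \<le> S" unfolding S_def by (rule infsum_nonneg) simp
    have "(\<Sum>j\<in>F. norm (c j) powr r) \<le> S" if "finite F" for F
      unfolding S_def using sm that by (intro finite_sum_le_infsum) auto
    then have "lp_bound p (\<lambda>j. norm (c j)) (S powr (1 / r))"
      using finite \<open>0 \<le> S\<close> by (simp add: lp_bound_ereal powr_powr)
    then show "\<exists>t. lp_bound p (\<lambda>j. norm (c j)) t" ..
  next
    assume "\<exists>t. lp_bound p (\<lambda>j. norm (c j)) t"
    then obtain t where "lp_bound p (\<lambda>j. norm (c j)) t" ..
    then have "bdd_above (sum (\<lambda>j. norm (c j) powr r) ` {F. F \<subseteq> UNIV \<and> finite F})"
      by (intro bdd_aboveI[of _ "t powr r"]) (auto simp: finite lp_bound_ereal)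
    then have "(\<lambda>j. norm (c j) powr r) summable_on UNIV"
      by (intro nonneg_bdd_above_summable_on) auto
    then show "c \<in> lp_space p" by (simp add: lp_space_def finite)
  qed
next
  case infinite
  show ?thesis
    by (auto simp: infinite lp_bound_infinity lp_space_def bdd_above_def)
qed

text \<open>Together with \<open>lp_norm_le\<close> this makes the norm the least admissible bound,
  so that estimates can be carried out with \<open>lp_bound\<close> and converted at the
  end.\<close>

lemma lp_bound_lp_norm:
  assumes "1 \<le> p" "c \<in> lp_space p"
  shows "lp_bound p (\<lambda>j. norm (c j)) (lp_norm p c)"
  using assms(1)
proof (cases rule: exponent_cases)
  case (finite r)
  have sm: "(\<lambda>j. norm (c j) powr r) summable_on UNIV" using assms by (simp add: lp_space_def finite)
  define S where "S = (\<Sum>\<^sub>\<infinity>j. norm (c j) powr r)"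
  have "0 \<le> S" unfolding S_def by (rule infsum_nonneg) simp
  have "(\<Sum>j\<in>F. norm (c j) powr r) \<le> S" if "finite F" for F
    unfolding S_def using sm that by (intro finite_sum_le_infsum) auto
  then show ?thesis
    using finite \<open>0 \<le> S\<close> by (simp add: lp_bound_ereal powr_powr lp_norm_def S_def)
next
  case infinite
  then show ?thesis using assms(2)
    by (auto simp: lp_bound_infinity lp_space_def lp_norm_def intro: cSUP_upper)
qed

lemma lp_norm_le:
  assumes "1 \<le> p" "lp_bound p (\<lambda>j. norm (c j)) t"
  shows "lp_norm p c \<le> t"
  using assms(1)
proof (cases rule: exponent_cases)
  case (finite r)
  have "c \<in> lp_space p" unfolding lp_space_iff_bound[OF assms(1)] using assms(2) ..
  then have sm: "(\<lambda>j. norm (c j) powr r) summable_on UNIV" by (simp add: lp_space_def finite)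
  have "(\<Sum>\<^sub>\<infinity>j. norm (c j) powr r) \<le> t powr r"
    using sm assms(2) by (intro infsum_le_finite_sums) (auto simp: finite lp_bound_ereal)
  then have "(\<Sum>\<^sub>\<infinity>j. norm (c j) powr r) powr (1 / r) \<le> (t powr r) powr (1 / r)"
    using finite by (intro powr_mono2 infsum_nonneg) auto
  then show ?thesis
    using finite lp_bound_nonneg[OF assms(2)] by (simp add: lp_norm_def powr_powr)
next
  case infinite
  then show ?thesis using assms(2)
    by (auto simp: lp_bound_infinity lp_norm_def intro: cSUP_least)
qed

section \<open>Windows\<close>

definition tent :: "real \<Rightarrow> real" where
  "tent x = max 0 (1 - \<bar>x\<bar>)"

lemma tent_nonneg: "0 \<le> tent x"
  by (simp add: tent_def)

lemma tent_le_1: "tent x \<le> 1"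
  by (simp add: tent_def)

lemma tent_eq_0: "1 \<le> \<bar>x\<bar> \<Longrightarrow> tent x = 0"
  by (simp add: tent_def)

lemma tent_Lipschitz: "\<bar>tent x - tent y\<bar> \<le> \<bar>x - y\<bar>"
  unfolding tent_def by linarith

lemma sum_tent_translates:
  "(\<Sum>i\<in>{-2..2::int}. tent (y - of_int i)) =
     tent (y + 2) + tent (y + 1) + tent y + tent (y - 1) + tent (y - 2)"
proof -
  have "{-2..2::int} = {-2, -1, 0, 1, 2}" by auto
  then show ?thesis by simp
qed

text \<open>For small shifts the difference vanishes outside \<open>[-2, 2]\<close>, where the integer translates of the
  tent sum to at least 1.\<close>

lemma tent_shift_diff:
  "\<bar>tent y - tent (y - z)\<bar>
     \<le> min 1 \<bar>z\<bar> * ((\<Sum>i\<in>{-2..2::int}. tent (y - of_int i)) + tent (y - z))"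
proof (cases "\<bar>z\<bar> \<le> 1")
  case True
  show ?thesis
  proof (cases "\<bar>y\<bar> \<le> 2")
    case True
    then have "1 \<le> tent (y + 2) + tent (y + 1) + tent y + tent (y - 1) + tent (y - 2)"
      unfolding tent_def by linarith
    then have "1 \<le> (\<Sum>i\<in>{-2..2::int}. tent (y - of_int i)) + tent (y - z)"
      unfolding sum_tent_translates using tent_nonneg[of "y - z"] by linarith
    then have "\<bar>z\<bar> * 1 \<le> \<bar>z\<bar> * ((\<Sum>i\<in>{-2..2::int}. tent (y - of_int i)) + tent (y - z))"
      by (intro mult_left_mono) auto
    then show ?thesis using tent_Lipschitz[of y "y - z"] \<open>\<bar>z\<bar> \<le> 1\<close> by simp
  next
    case False
    then have "tent y = 0" "tent (y - z) = 0" using \<open>\<bar>z\<bar> \<le> 1\<close> by (auto intro!: tent_eq_0)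
    then show ?thesis by (simp add: sum_nonneg tent_nonneg)
  qed
next
  case False
  \<comment> \<open>For large shifts the minimum is 1 and the triangle inequality is enough. The
    point \<open>y - z\<close> can lie far from \<open>y\<close>, which is why the bound carries the
    separate term \<open>tent (y - z)\<close>.\<close>
  have "\<bar>tent y - tent (y - z)\<bar> \<le> tent y + tent (y - z)"
    using tent_nonneg[of y] tent_nonneg[of "y - z"] by linarith
  also have "\<dots> \<le> (\<Sum>i\<in>{-2..2::int}. tent (y - of_int i)) + tent (y - z)"
    unfolding sum_tent_translates
    using tent_nonneg[of "y + 2"] tent_nonneg[of "y + 1"] tent_nonneg[of "y - 1"] tent_nonneg[of "y - 2"]
    by linarith
  finally show ?thesis using False by simp
qed

section \<open>Windowed sequences and their norms\<close>

definition window :: "int \<Rightarrow> int \<Rightarrow> (int \<Rightarrow> complex) \<Rightarrow> int \<Rightarrow> complex" where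
  "window N m c j = of_real (tent (of_int (j - m) / of_int N)) * c j"

lemma norm_window: "norm (window N m c j) = tent (of_int (j - m) / of_int N) * norm (c j)"
  by (simp add: window_def norm_mult tent_nonneg)

text \<open>The window lives on the indices within distance \<open>N\<close> of \<open>m\<close>, so
  the windowed sequence is dominated by finitely many one-point sequences, whose norms are the same
  for every exponent.\<close>

lemma window_bound:
  assumes "1 \<le> p" "0 < N"
  shows "lp_bound p (\<lambda>j. norm (window N m c j)) (\<Sum>i\<in>{-N..N}. norm (c (m + i)))"
proof (rule lp_bound_mono[OF assms(1)])
  show "lp_bound p (\<lambda>j. \<Sum>i\<in>{-N..N}. if j = m + i then norm (c (m + i)) else 0)
      (\<Sum>i\<in>{-N..N}. \<bar>norm (c (m + i))\<bar>)"
    using assms(1) by (intro lp_bound_sum lp_bound_single) auto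
  fix j
  show "\<bar>norm (window N m c j)\<bar> \<le> \<bar>\<Sum>i\<in>{-N..N}. if j = m + i then norm (c (m + i)) else 0\<bar>"
  proof (cases "\<bar>j - m\<bar> \<le> N")
    case True
    have "(\<Sum>i\<in>{-N..N}. if j = m + i then norm (c (m + i)) else 0)
        = (\<Sum>i\<in>{-N..N}. if i = j - m then norm (c j) else 0)"
      by (rule sum.cong) auto
    also have "\<dots> = norm (c j)"
      using True by (subst sum.delta) auto
    finally show ?thesis
      by (simp add: norm_window tent_nonneg mult_left_le_one_le tent_le_1)
  next
    case False
    then have "1 \<le> \<bar>of_int (j - m) / of_int N :: real\<bar>"
      using assms(2) by (simp add: abs_divide)
    then show ?thesis by (simp add: norm_window tent_eq_0)
  qed
qed simp

lemma window_in_lp_space: "1 \<le> p \<Longrightarrow> 0 < N \<Longrightarrow> window N m c \<in> lp_space p"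
  using lp_space_iff_bound[of p "window N m c"] window_bound[of p N m c] by auto

lemma lp_norm_nonneg: "1 \<le> p \<Longrightarrow> c \<in> lp_space p \<Longrightarrow> 0 \<le> lp_norm p c"
  by (rule lp_bound_nonneg[OF lp_bound_lp_norm])

lemma lp_norm_window_le:
  assumes "1 \<le> p" "0 < N"
  shows "lp_norm p (window N m c) \<le> (\<Sum>i\<in>{-N..N}. norm (c (m + i)))"
  by (rule lp_norm_le[OF assms(1) window_bound[OF assms]])

text \<open>The window has height 1 at its centre, and a norm dominates each single entry.\<close>

lemma norm_le_lp_norm_window:
  assumes "1 \<le> p" "0 < N"
  shows "norm (c m) \<le> lp_norm p (window N m c)"
proof -
  have "\<bar>norm (window N m c m)\<bar> \<le> lp_norm p (window N m c)"
    by (rule lp_bound_point[OF assms(1) lp_bound_lp_norm[OF assms(1) window_in_lp_space[OF assms]]])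
  then show ?thesis by (simp add: norm_window tent_def)
qed

text \<open>Here the two exponents meet: the local norm with exponent \<open>p\<close> is at most a
  sum of \<open>2 * N + 1\<close> translates of \<open>norm (c j)\<close>, and each translate has
  the same bound with exponent \<open>q\<close>.\<close>

lemma lp_bound_lp_norm_window:
  assumes "1 \<le> p" "1 \<le> q" "0 < N" "lp_bound q (\<lambda>j. norm (c j)) t"
  shows "lp_bound q (\<lambda>m. lp_norm p (window N m c)) ((2 * of_int N + 1) * t)"
proof (rule lp_bound_mono[OF assms(2)])
  show "lp_bound q (\<lambda>m. \<Sum>i\<in>{-N..N}. norm (c (m + i))) (\<Sum>i\<in>{-N..N}. t)"
    using assms by (intro lp_bound_sum lp_bound_shift[of q "\<lambda>j. norm (c j)"]) auto
  show "\<bar>lp_norm p (window N m c)\<bar> \<le> \<bar>\<Sum>i\<in>{-N..N}. norm (c (m + i))\<bar>" for m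
    using lp_norm_window_le[OF assms(1,3), of m c]
      lp_norm_nonneg[OF assms(1) window_in_lp_space[OF assms(1,3)], of m c] by linarith
  show "(\<Sum>i\<in>{-N..N}. t) \<le> (2 * of_int N + 1) * t"
    using assms(3) by simp
qed

text \<open>A finite set \<open>F\<close> carries all but \<open>e / 2\<close> of the mass of
  \<open>s\<close>. Off \<open>F\<close> the weight is at most 1; on \<open>F\<close> it is at most
  \<open>\<bar>k\<bar> / N\<close>, which a large \<open>N\<close> makes harmless.\<close>

lemma infsum_truncated_weight_small:
  fixes s :: "int \<Rightarrow> real"
  assumes "\<And>k. 0 \<le> s k" "s summable_on UNIV" "0 < e"
  obtains N :: int where "0 < N" "(\<Sum>\<^sub>\<infinity>k. s k * min 1 \<bar>of_int k / of_int N\<bar>) \<le> e"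
proof -
  obtain F where F: "finite F" "dist (sum s F) (infsum s UNIV) \<le> e / 2"
    using infsum_finite_approximation[OF assms(2), of "e / 2"] assms(3) by auto
  define B where "B = (\<Sum>k\<in>F. s k * \<bar>of_int k\<bar>)"
  have "0 \<le> B" unfolding B_def using assms(1) by (intro sum_nonneg) auto
  \<comment> \<open>The quotient ensures \<open>B / N \<le> e / 2\<close>, and adding 1 keeps
    \<open>N\<close> positive when \<open>B\<close> is 0.\<close>
  define N where "N = \<lceil>2 * B / e\<rceil> + 1"
  have "0 \<le> 2 * B / e" using \<open>0 \<le> B\<close> assms(3) by simp
  then have N: "0 < N" "2 * B / e \<le> of_int N"
    unfolding N_def by linarith+
  have "(\<Sum>\<^sub>\<infinity>k. s k * min 1 \<bar>of_int k / of_int N\<bar>) \<le> e"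
  proof (rule infsum_le_finite_sums)
    show "(\<lambda>k. s k * min 1 \<bar>of_int k / of_int N\<bar>) summable_on UNIV"
      using assms(1) by (intro summable_on_comparison_test[OF assms(2)]) (auto simp: mult_left_le)
    fix G :: "int set" assume G: "finite G"
    have "(\<Sum>k\<in>G. s k * min 1 \<bar>of_int k / of_int N\<bar>)
        \<le> (\<Sum>k\<in>F \<union> (G - F). s k * min 1 \<bar>of_int k / of_int N\<bar>)"
      using F(1) G assms(1) by (intro sum_mono2) auto
    also have "\<dots> = (\<Sum>k\<in>F. s k * min 1 \<bar>of_int k / of_int N\<bar>)
        + (\<Sum>k\<in>G - F. s k * min 1 \<bar>of_int k / of_int N\<bar>)"
      using F(1) G by (intro sum.union_disjoint) auto
    also have "\<dots> \<le> (\<Sum>k\<in>F. s k * \<bar>of_int k\<bar> / of_int N) + (\<Sum>k\<in>G - F. s k)"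
      using N(1) assms(1)
      by (intro add_mono sum_mono) (auto simp: mult_left_le abs_divide intro!: mult_left_mono
          simp flip: times_divide_eq_right)
    also have "\<dots> = B / of_int N + (\<Sum>k\<in>G - F. s k)"
      by (simp add: B_def sum_divide_distrib)
    also have "\<dots> \<le> e / 2 + e / 2"
    proof (rule add_mono)
      show "B / of_int N \<le> e / 2"
        using N assms(3) by (simp add: field_simps)
      have "sum s F + sum s (G - F) = sum s (F \<union> (G - F))"
        using F(1) G by (intro sum.union_disjoint[symmetric]) auto
      also have "\<dots> \<le> infsum s UNIV"
        using F(1) G assms by (intro finite_sum_le_infsum) auto
      finally show "sum s (G - F) \<le> e / 2"
        using F(2) unfolding dist_real_def by linarith
    qed
    finally show "(\<Sum>k\<in>G. s k * min 1 \<bar>of_int k / of_int N\<bar>) \<le> e" by simp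
  qed
  with N(1) show ?thesis by (rule that)
qed

section \<open>Matrices dominated by a summable convolution kernel\<close>

locale dominated_matrix =
  fixes a :: "int \<Rightarrow> int \<Rightarrow> complex" and s :: "int \<Rightarrow> real"
  assumes entry_le: "norm (a j (j + k)) \<le> s k"
    and kernel_summable: "s summable_on UNIV"
begin

lemma kernel_nonneg: "0 \<le> s k"
  using entry_le[of 0 k] norm_ge_zero order_trans by blast

lemma kernel_mult_summable:
  assumes "\<And>k. 0 \<le> f k" "\<And>k. f k \<le> M"
  shows "(\<lambda>k. s k * f k) summable_on UNIV"
  using assms kernel_nonneg
  by (intro summable_on_comparison_test[OF summable_on_cmult_left[OF kernel_summable, of M]])
    (auto intro: mult_left_mono)

lemma matrix_op_shift: "matrix_op a c j = (\<Sum>\<^sub>\<infinity>k. a j (j + k) * c (j + k))"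
  unfolding matrix_op_def
  by (rule infsum_reindex_bij_witness[where i = "\<lambda>k. j + k" and j = "\<lambda>k. k - j"]) auto

lemma row_abs_summable:
  assumes "\<And>j. norm (c j) \<le> M"
  shows "(\<lambda>k. norm (a j (j + k) * c (j + k))) summable_on UNIV"
  using assms entry_le kernel_nonneg
  by (intro summable_on_comparison_test[OF kernel_mult_summable[of "\<lambda>k. norm (c (j + k))" M]])
    (auto simp: norm_mult intro: mult_right_mono)

lemma row_summable:
  assumes "\<And>j. norm (c j) \<le> M"
  shows "(\<lambda>k. a j (j + k) * c (j + k)) summable_on UNIV"
  using row_abs_summable[OF assms] by (rule abs_summable_summable)

text \<open>The coefficients \<open>d\<close> are arbitrary rather than of the form
  \<open>c (j + k)\<close>, so that the row of a commutator, whose coefficients also involve the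
  window at \<open>j\<close>, is covered.\<close>

lemma norm_row_le:
  assumes "\<And>k. norm (d k) \<le> M"
  shows "norm (\<Sum>\<^sub>\<infinity>k. a j (j + k) * d k) \<le> (\<Sum>\<^sub>\<infinity>k. s k * norm (d k))"
proof (rule norm_infsum_le[OF has_sum_infsum has_sum_infsum])
  show "(\<lambda>k. a j (j + k) * d k) summable_on UNIV"
    using row_summable[of "\<lambda>i. d (i - j)" M j] assms by simp
  show "(\<lambda>k. s k * norm (d k)) summable_on UNIV"
    using assms by (intro kernel_mult_summable) auto
qed (auto simp: norm_mult intro: mult_right_mono entry_le)

text \<open>Young's inequality: the matrix is dominated by convolution with \<open>s\<close>, and
  the diagonal with offset \<open>k\<close> contributes a translate of \<open>norm (c j)\<close>
  scaled by \<open>s k\<close>.\<close>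

lemma lp_bound_matrix_op:
  assumes "1 \<le> q" "lp_bound q (\<lambda>j. norm (c j)) t"
  shows "lp_bound q (\<lambda>j. norm (matrix_op a c j)) (infsum s UNIV * t)"
proof -
  have le: "norm (c j) \<le> t" for j using lp_bound_point[OF assms, of j] by simp
  have "lp_bound q (\<lambda>j. \<Sum>\<^sub>\<infinity>k. s k * norm (c (j + k))) (\<Sum>\<^sub>\<infinity>k. s k * t)"
    using assms le kernel_nonneg kernel_summable
    by (intro lp_bound_infsum lp_bound_scale lp_bound_shift[of q "\<lambda>j. norm (c j)"]
        kernel_mult_summable[of _ t] summable_on_cmult_left) auto
  then show ?thesis
  proof (rule lp_bound_mono[OF assms(1)])
    fix j
    have "norm (matrix_op a c j) \<le> (\<Sum>\<^sub>\<infinity>k. s k * norm (c (j + k)))"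
      unfolding matrix_op_shift using le by (rule norm_row_le)
    then show "\<bar>norm (matrix_op a c j)\<bar> \<le> \<bar>\<Sum>\<^sub>\<infinity>k. s k * norm (c (j + k))\<bar>" by simp
  qed (simp add: infsum_cmult_left')
qed

lemma matrix_op_in_lp_space:
  assumes "1 \<le> q" "c \<in> lp_space q"
  shows "matrix_op a c \<in> lp_space q"
  unfolding lp_space_iff_bound[OF assms(1)]
  by (rule exI, rule lp_bound_matrix_op[OF assms(1) lp_bound_lp_norm[OF assms]])

section \<open>Commutators with windows and the localised lower bound\<close>

text \<open>The commutator has entries \<open>a j (j + k)\<close> times a difference of window
  values at \<open>j + k\<close> and \<open>j\<close>, which \<open>tent_shift_diff\<close>
  controls. Everything on the right is again a windowed copy of \<open>c\<close> evaluated at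
  \<open>j + k\<close>, so its norm over \<open>j\<close> is a local norm at another centre.\<close>

lemma norm_commutator_le:
  assumes "\<And>j. norm (c j) \<le> M" "0 < N"
  shows "norm (matrix_op a (window N m c) j - window N m (matrix_op a c) j)
    \<le> (\<Sum>\<^sub>\<infinity>k. s k * min 1 \<bar>of_int k / of_int N\<bar> *
        ((\<Sum>i\<in>{-2..2}. norm (window N (m + i * N) c (j + k))) + norm (window N (m + k) c (j + k))))"
    (is "_ \<le> (\<Sum>\<^sub>\<infinity>k. ?r k)")
proof -
  define w where "w i = tent (of_int (i - m) / of_int N)" for i
  have w: "0 \<le> w i" "w i \<le> 1" for i by (auto simp: w_def tent_nonneg tent_le_1)
  have M: "0 \<le> M" using assms(1)[of 0] norm_ge_zero order_trans by blast
  have wle: "norm (window N l c i) \<le> M" for l i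
    using mult_mono[OF tent_le_1 assms(1)[of i]] by (simp add: norm_window)
  have diff: "\<bar>w (j + k) - w j\<bar> * norm (c (j + k)) \<le> min 1 \<bar>of_int k / of_int N\<bar> *
      ((\<Sum>i\<in>{-2..2}. norm (window N (m + i * N) c (j + k))) + norm (window N (m + k) c (j + k)))" for k
  proof -
    \<comment> \<open>With this choice, \<open>tent (y - of_int i)\<close> is the window centred at
      \<open>m + i * N\<close> and \<open>tent (y - z)\<close> the one centred at
      \<open>m + k\<close>, both evaluated at \<open>j + k\<close>.\<close>
    define y z :: real where "y = of_int (j + k - m) / of_int N" and "z = of_int k / of_int N"
    have yz: "y - z = of_int (j - m) / of_int N"
      by (simp add: y_def z_def diff_divide_distrib[symmetric])
    have translate: "norm (window N (m + i * N) c (j + k)) = tent (y - of_int i) * norm (c (j + k))" for i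
    proof -
      have "of_int (j + k - (m + i * N)) / of_int N = y - of_int i"
        using assms(2) by (simp add: y_def field_simps)
      then show ?thesis by (simp add: norm_window)
    qed
    have "norm (window N (m + k) c (j + k)) = tent (y - z) * norm (c (j + k))"
      unfolding yz by (simp add: norm_window)
    then have "(\<Sum>i\<in>{-2..2}. norm (window N (m + i * N) c (j + k))) + norm (window N (m + k) c (j + k))
        = ((\<Sum>i\<in>{-2..2}. tent (y - of_int i)) + tent (y - z)) * norm (c (j + k))"
      by (simp add: translate sum_distrib_right distrib_right)
    moreover have "w (j + k) = tent y" "w j = tent (y - z)"
      unfolding yz by (simp_all add: w_def y_def)
    ultimately show ?thesis
      using mult_right_mono[OF tent_shift_diff[of y z] norm_ge_zero[of "c (j + k)"]]
      by (simp only: z_def mult.assoc)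
  qed
  \<comment> \<open>The difference of two \<open>infsum\<close> values may be merged into one series
    only because both row series converge, which boundedness of \<open>c\<close> provides.\<close>
  have r1: "(\<lambda>k. a j (j + k) * window N m c (j + k)) summable_on UNIV"
    using wle by (rule row_summable)
  have r2: "(\<lambda>k. - of_real (w j) * (a j (j + k) * c (j + k))) summable_on UNIV"
    using row_summable[OF assms(1)] by (rule summable_on_cmult_right)
  have "window N m (matrix_op a c) j = (\<Sum>\<^sub>\<infinity>k. of_real (w j) * (a j (j + k) * c (j + k)))"
    by (simp add: window_def w_def matrix_op_shift infsum_cmult_right')
  then have "matrix_op a (window N m c) j - window N m (matrix_op a c) j
      = (\<Sum>\<^sub>\<infinity>k. a j (j + k) * window N m c (j + k) + - of_real (w j) * (a j (j + k) * c (j + k)))"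
    unfolding matrix_op_shift infsum_add[OF r1 r2] infsum_cmult_right' by simp
  also have "\<dots> = (\<Sum>\<^sub>\<infinity>k. a j (j + k) * (of_real (w (j + k) - w j) * c (j + k)))"
    by (rule infsum_cong) (simp add: window_def w_def algebra_simps)
  also have "norm \<dots> \<le> (\<Sum>\<^sub>\<infinity>k. s k * norm (of_real (w (j + k) - w j) * c (j + k)))"
  proof (rule norm_row_le)
    show "norm (of_real (w (j + k) - w j) * c (j + k)) \<le> 1 * M" for k
      unfolding norm_mult norm_of_real using w[of "j + k"] w[of j] assms(1)
      by (intro mult_mono) auto
  qed
  also have "\<dots> \<le> (\<Sum>\<^sub>\<infinity>k. ?r k)"
  proof (rule infsum_mono)
    show "(\<lambda>k. s k * norm (of_real (w (j + k) - w j) * c (j + k))) summable_on UNIV"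
    proof (rule kernel_mult_summable)
      show "norm (of_real (w (j + k) - w j) * c (j + k)) \<le> 1 * M" for k
        unfolding norm_mult norm_of_real using w[of "j + k"] w[of j] assms(1)
        by (intro mult_mono) auto
    qed simp
    show "?r summable_on UNIV"
      unfolding mult.assoc
    proof (rule kernel_mult_summable)
      fix k
      have "(\<Sum>i\<in>{-2..2}. norm (window N (m + i * N) c (j + k))) \<le> (\<Sum>i\<in>{-2..2::int}. M)"
        by (intro sum_mono wle)
      then show "min 1 \<bar>of_int k / of_int N\<bar> *
          ((\<Sum>i\<in>{-2..2}. norm (window N (m + i * N) c (j + k))) + norm (window N (m + k) c (j + k)))
          \<le> 1 * (5 * M + M)"
        using wle[of "m + k" "j + k"] M
        by (intro mult_mono add_mono) (auto intro!: add_nonneg_nonneg sum_nonneg)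
    qed (auto intro!: mult_nonneg_nonneg add_nonneg_nonneg sum_nonneg)
    show "s k * norm (of_real (w (j + k) - w j) * c (j + k)) \<le> ?r k" for k
      using mult_left_mono[OF diff kernel_nonneg]
      by (simp add: norm_mult mult.assoc flip: of_real_diff)
  qed
  finally show ?thesis .
qed

text \<open>The assumed inequality concerns the windowed sequence, whose image under the matrix is
  the windowed image of \<open>c\<close> plus a commutator. Only boundedness is asked of
  \<open>c\<close>, so the estimate applies to members of \<open>lp_space q\<close>.\<close>

lemma lp_norm_window_matrix_op:
  assumes "1 \<le> p" "0 < N" "\<And>j. norm (c j) \<le> M" "0 \<le> C"
    "lp_norm p (window N m c) \<le> C * lp_norm p (matrix_op a (window N m c))"
  defines "u \<equiv> \<lambda>l. lp_norm p (window N l c)"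
  shows "u m \<le> C * (lp_norm p (window N m (matrix_op a c)) +
    (\<Sum>\<^sub>\<infinity>k. s k * min 1 \<bar>of_int k / of_int N\<bar> * ((\<Sum>i\<in>{-2..2}. u (m + i * N)) + u (m + k))))"
    (is "_ \<le> C * (?v + (\<Sum>\<^sub>\<infinity>k. ?t k))")
proof -
  define \<omega> where "\<omega> k = min 1 \<bar>of_int k / of_int N :: real\<bar>" for k
  have \<omega>: "0 \<le> \<omega> k" "\<omega> k \<le> 1" for k by (auto simp: \<omega>_def)
  define g where "g k j = (\<Sum>i\<in>{-2..2}. norm (window N (m + i * N) c (j + k)))
      + norm (window N (m + k) c (j + k))" for k j
  define G where "G k = (\<Sum>i\<in>{-2..2}. u (m + i * N)) + u (m + k)" for k
  have wp: "lp_bound p (\<lambda>j. norm (window N l c (j + k))) (u l)" for l k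
    unfolding u_def using assms(1,2)
    by (intro lp_bound_shift[of p "\<lambda>j. norm (window N l c j)"] lp_bound_lp_norm window_in_lp_space)
  have gG: "lp_bound p (g k) (G k)" for k
    unfolding g_def G_def using assms(1) by (intro lp_bound_add lp_bound_sum wp) auto
  \<comment> \<open>This crude bound, uniform in \<open>l\<close>, serves only the convergence of
    the series over \<open>k\<close>.\<close>
  have uM: "u l \<le> (2 * of_int N + 1) * M" for l
  proof -
    have "u l \<le> (\<Sum>i\<in>{-N..N}. norm (c (l + i)))"
      unfolding u_def using assms(1,2) by (rule lp_norm_window_le)
    also have "\<dots> \<le> (\<Sum>i\<in>{-N..N}. M)"
      by (intro sum_mono assms(3))
    finally show ?thesis using assms(2) by simp
  qed
  define B where "B = 6 * ((2 * of_int N + 1) * M)"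
  have "(\<Sum>i\<in>{-2..2::int}. u (m + i * N)) \<le> (\<Sum>i\<in>{-2..2::int}. (2 * of_int N + 1) * M)"
    by (intro sum_mono uM)
  then have GB: "G k \<le> B" for k
    using uM[of "m + k"] by (simp add: G_def B_def)
  have G0: "0 \<le> G k" for k by (rule lp_bound_nonneg[OF gG])
  have gk: "0 \<le> g k j" "g k j \<le> B" for k j
    using lp_bound_point[OF assms(1) gG, of k j] GB[of k]
    by (auto simp: g_def intro!: add_nonneg_nonneg sum_nonneg)
  have "lp_bound p (\<lambda>j. \<Sum>\<^sub>\<infinity>k. s k * \<omega> k * g k j) (\<Sum>\<^sub>\<infinity>k. s k * \<omega> k * G k)"
  proof (rule lp_bound_infsum[OF assms(1)])
    show "lp_bound p (\<lambda>j. s k * \<omega> k * g k j) (s k * \<omega> k * G k)" for k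
      using assms(1) gG \<omega> kernel_nonneg by (intro lp_bound_scale) auto
    have le: "\<omega> k * x \<le> 1 * B" if "0 \<le> x" "x \<le> B" for k x
      using that \<omega> by (intro mult_mono) auto
    show "(\<lambda>k. s k * \<omega> k * g k j) summable_on UNIV" for j
      unfolding mult.assoc using \<omega> gk le by (intro kernel_mult_summable[of _ "1 * B"]) auto
    show "(\<lambda>k. s k * \<omega> k * G k) summable_on UNIV"
      unfolding mult.assoc using \<omega> G0 GB le by (intro kernel_mult_summable[of _ "1 * B"]) auto
  qed
  moreover have "lp_bound p (\<lambda>j. norm (window N m (matrix_op a c) j)) ?v"
    using assms(1,2) by (intro lp_bound_lp_norm window_in_lp_space)
  ultimately have "lp_bound p (\<lambda>j. norm (window N m (matrix_op a c) j) + (\<Sum>\<^sub>\<infinity>k. s k * \<omega> k * g k j))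
      (?v + (\<Sum>\<^sub>\<infinity>k. s k * \<omega> k * G k))"
    using assms(1) by (intro lp_bound_add)
  then have "lp_bound p (\<lambda>j. norm (matrix_op a (window N m c) j)) (?v + (\<Sum>\<^sub>\<infinity>k. s k * \<omega> k * G k))"
  proof (rule lp_bound_mono[OF assms(1)])
    fix j
    have "norm (matrix_op a (window N m c) j - window N m (matrix_op a c) j)
        \<le> (\<Sum>\<^sub>\<infinity>k. s k * \<omega> k * g k j)"
      unfolding \<omega>_def g_def using assms(3,2) by (rule norm_commutator_le)
    then have "norm (matrix_op a (window N m c) j)
        \<le> norm (window N m (matrix_op a c) j) + (\<Sum>\<^sub>\<infinity>k. s k * \<omega> k * g k j)"
      using norm_triangle_ineq2[of "matrix_op a (window N m c) j" "window N m (matrix_op a c) j"]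
      by linarith
    then show "\<bar>norm (matrix_op a (window N m c) j)\<bar>
        \<le> \<bar>norm (window N m (matrix_op a c) j) + (\<Sum>\<^sub>\<infinity>k. s k * \<omega> k * g k j)\<bar>"
      unfolding abs_norm_cancel by (rule order_trans[OF _ abs_ge_self])
  qed simp
  then have "lp_norm p (matrix_op a (window N m c)) \<le> ?v + (\<Sum>\<^sub>\<infinity>k. s k * \<omega> k * G k)"
    using assms(1) by (intro lp_norm_le)
  then have "C * lp_norm p (matrix_op a (window N m c)) \<le> C * (?v + (\<Sum>\<^sub>\<infinity>k. s k * \<omega> k * G k))"
    using assms(4) by (rule mult_left_mono)
  then show ?thesis using assms(5) by (simp add: u_def \<omega>_def G_def)
qed

section \<open>Absorption of the commutator term and transfer to another exponent\<close>

lemma lower_bound_transfer: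
  assumes "1 \<le> p" "1 \<le> q" "0 < C"
    "\<And>c. c \<in> lp_space p \<Longrightarrow> lp_norm p c \<le> C * lp_norm p (matrix_op a c)"
  obtains K where "0 \<le> K" "\<And>c. c \<in> lp_space q \<Longrightarrow> lp_norm q c \<le> K * lp_norm q (matrix_op a c)"
proof -
  \<comment> \<open>Five translates and one shifted window give the factor 6, so the kernel mass
    \<open>1 / (12 * C)\<close> leaves a total factor of at most 1/2.\<close>
  obtain N :: int where N: "0 < N"
      "(\<Sum>\<^sub>\<infinity>k. s k * min 1 \<bar>of_int k / of_int N\<bar>) \<le> 1 / (12 * C)"
    using infsum_truncated_weight_small[OF kernel_nonneg kernel_summable, of "1 / (12 * C)"] assms(3)
    by auto
  define K where "K = 2 * C * (2 * of_int N + 1)"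
  have "lp_norm q c \<le> K * lp_norm q (matrix_op a c)" if c: "c \<in> lp_space q" for c
  proof -
    define \<omega> where "\<omega> k = min 1 \<bar>of_int k / of_int N :: real\<bar>" for k
    have \<omega>: "0 \<le> \<omega> k" "\<omega> k \<le> 1" for k by (auto simp: \<omega>_def)
    define M where "M = lp_norm q c"
    have M: "norm (c j) \<le> M" for j
      using lp_bound_point[OF assms(2) lp_bound_lp_norm[OF assms(2) c], of j] by (simp add: M_def)
    define u where "u m = lp_norm p (window N m c)" for m
    have u0: "0 \<le> u m" for m
      unfolding u_def using assms(1) N(1) by (intro lp_norm_nonneg window_in_lp_space)
    define U where "U = lp_norm q (\<lambda>m. of_real (u m))"
    \<comment> \<open>Absorption requires beforehand that \<open>u\<close> lies in the sequence
      space with exponent \<open>q\<close>; otherwise \<open>U\<close> would be a meaningless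
      default value.\<close>
    have "lp_bound q u ((2 * of_int N + 1) * M)"
      unfolding u_def M_def using assms(1,2) N(1) c
      by (intro lp_bound_lp_norm_window lp_bound_lp_norm)
    then have "(\<lambda>m. of_real (u m)) \<in> lp_space q"
      using u0 assms(2) by (auto simp: lp_space_iff_bound)
    then have U: "lp_bound q u U"
      using lp_bound_lp_norm[OF assms(2)] u0 by (fastforce simp: U_def)
    have uU: "u m \<le> U" for m using lp_bound_point[OF assms(2) U, of m] by simp
    define W where "W = (2 * of_int N + 1) * lp_norm q (matrix_op a c)"
    have W: "lp_bound q (\<lambda>m. lp_norm p (window N m (matrix_op a c))) W"
      unfolding W_def using assms(1,2) N(1) c
      by (intro lp_bound_lp_norm_window lp_bound_lp_norm matrix_op_in_lp_space)
    define g where "g k m = (\<Sum>i\<in>{-2..2}. u (m + i * N)) + u (m + k)" for k m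
    have g: "lp_bound q (g k) (6 * U)" for k
    proof -
      have "lp_bound q (g k) ((\<Sum>i\<in>{-2..2::int}. U) + U)"
        unfolding g_def using assms(2) U by (intro lp_bound_add lp_bound_sum lp_bound_shift[of q u]) auto
      then show ?thesis by simp
    qed
    have g0: "0 \<le> g k m" for k m
      using u0 by (auto simp: g_def intro!: add_nonneg_nonneg sum_nonneg)
    have gU: "\<omega> k * g k m \<le> 1 * (6 * U)" for k m
      using lp_bound_point[OF assms(2) g, of k m] \<omega> g0 by (intro mult_mono) auto
    define \<delta> where "\<delta> = (\<Sum>\<^sub>\<infinity>k. s k * \<omega> k)"
    have "lp_bound q (\<lambda>m. \<Sum>\<^sub>\<infinity>k. s k * \<omega> k * g k m) (\<Sum>\<^sub>\<infinity>k. s k * \<omega> k * (6 * U))"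
    proof (rule lp_bound_infsum[OF assms(2)])
      show "lp_bound q (\<lambda>m. s k * \<omega> k * g k m) (s k * \<omega> k * (6 * U))" for k
        using assms(2) g \<omega> kernel_nonneg by (intro lp_bound_scale) auto
      show "(\<lambda>k. s k * \<omega> k * g k m) summable_on UNIV" for m
        unfolding mult.assoc using \<omega> g0 gU by (intro kernel_mult_summable[of _ "1 * (6 * U)"]) auto
      show "(\<lambda>k. s k * \<omega> k * (6 * U)) summable_on UNIV"
        using \<omega> by (intro summable_on_cmult_left kernel_mult_summable[of _ 1]) auto
    qed
    then have "lp_bound q (\<lambda>m. C * (lp_norm p (window N m (matrix_op a c))
        + (\<Sum>\<^sub>\<infinity>k. s k * \<omega> k * g k m))) (C * (W + \<delta> * (6 * U)))"
      unfolding \<delta>_def infsum_cmult_left' using assms(2,3) W by (intro lp_bound_scale lp_bound_add) auto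
    then have "lp_bound q (\<lambda>m. norm (of_real (u m) :: complex)) (C * (W + \<delta> * (6 * U)))"
    proof (rule lp_bound_mono[OF assms(2)])
      fix m
      have "u m \<le> C * (lp_norm p (window N m (matrix_op a c)) + (\<Sum>\<^sub>\<infinity>k. s k * \<omega> k * g k m))"
        unfolding u_def \<omega>_def g_def using assms N(1) M window_in_lp_space
        by (intro lp_norm_window_matrix_op) auto
      then show "\<bar>norm (of_real (u m) :: complex)\<bar>
          \<le> \<bar>C * (lp_norm p (window N m (matrix_op a c)) + (\<Sum>\<^sub>\<infinity>k. s k * \<omega> k * g k m))\<bar>"
        using u0[of m] by simp
    qed simp
    then have "U \<le> C * (W + \<delta> * (6 * U))"
      unfolding U_def using assms(2) by (intro lp_norm_le)
    \<comment> \<open>Since \<open>U\<close> is a real number, half of it can be subtracted from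
      both sides of the preceding estimate.\<close>
    moreover have "C * (\<delta> * (6 * U)) \<le> U / 2"
    proof -
      have "(C * \<delta> * 6) * U \<le> (1 / 2) * U"
        using N(2) assms(3) lp_bound_nonneg[OF U]
        by (intro mult_right_mono) (auto simp: \<delta>_def \<omega>_def field_simps)
      then show ?thesis by (simp add: mult_ac)
    qed
    ultimately have "U \<le> 2 * C * W" by (simp add: distrib_left)
    moreover have "lp_bound q (\<lambda>j. norm (c j)) U"
    proof (rule lp_bound_mono[OF assms(2) U])
      show "\<bar>norm (c j)\<bar> \<le> \<bar>u j\<bar>" for j
        using norm_le_lp_norm_window[OF assms(1) N(1), of c j] u0[of j] by (simp add: u_def)
    qed simp
    then have "lp_norm q c \<le> U" using assms(2) by (intro lp_norm_le)
    ultimately show ?thesis by (simp add: K_def W_def mult_ac)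
  qed
  moreover have "0 \<le> K" using assms(3) N(1) by (simp add: K_def)
  ultimately show ?thesis using that by blast
qed

end

section \<open>From extended-valued suprema to a real kernel, and the conclusion\<close>

lemma dominated_matrix_kernel:
  fixes a :: "int \<Rightarrow> int \<Rightarrow> complex"
  assumes "(\<Sum>\<^sub>\<infinity>k. SUP j. ennreal (norm (a j (j + k)))) < \<infinity>"
  shows "dominated_matrix a (\<lambda>k. enn2real (SUP j. ennreal (norm (a j (j + k)))))"
proof -
  define t where "t k = (SUP j. ennreal (norm (a j (j + k))))" for k
  have t: "infsum t UNIV < \<infinity>" using assms by (simp add: t_def[abs_def])
  have le: "sum t F \<le> infsum t UNIV" if "finite F" for F
    using that infsum_mono_neutral[of t F t UNIV]
    by (simp add: nonneg_summable_on_complete)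
  \<comment> \<open>A finite total forces every supremum to be finite. This matters because
    \<open>enn2real\<close> sends infinity to 0, which would not dominate the entries.\<close>
  have fin: "t k < \<infinity>" for k
    using le[of "{k}"] t by (simp add: order.strict_trans1)
  show ?thesis
    unfolding t_def[symmetric]
  proof
    fix j k
    have "ennreal (norm (a j (j + k))) \<le> t k"
      unfolding t_def by (rule SUP_upper) simp
    also have "t k = ennreal (enn2real (t k))" using fin[of k] by simp
    finally show "norm (a j (j + k)) \<le> enn2real (t k)" by simp
  next
    have "(\<Sum>k\<in>F. enn2real (t k)) \<le> enn2real (infsum t UNIV)" if "finite F" for F
    proof -
      have "ennreal (\<Sum>k\<in>F. enn2real (t k)) = (\<Sum>k\<in>F. ennreal (enn2real (t k)))"
        by (simp add: sum_ennreal)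
      also have "\<dots> = sum t F" using fin by simp
      also have "\<dots> \<le> infsum t UNIV" using that by (rule le)
      also have "\<dots> = ennreal (enn2real (infsum t UNIV))" using t by simp
      finally show ?thesis by simp
    qed
    then show "(\<lambda>k. enn2real (t k)) summable_on UNIV"
      by (intro nonneg_bdd_above_summable_on bdd_aboveI[of _ "enn2real (infsum t UNIV)"]) auto
  qed
qed

theorem theorem1p2:
  fixes a :: "int \<Rightarrow> int \<Rightarrow> complex"
  assumes "(\<Sum>\<^sub>\<infinity>k. SUP j. ennreal (norm (a j (j + k)))) < \<infinity>"
    and "\<exists>p\<ge>1. lp_stable p (matrix_op a)"
  shows "\<forall>q\<ge>1. lp_stable q (matrix_op a)"
proof (intro allI impI)
  fix q :: ereal assume q: "1 \<le> q"
  interpret dominated_matrix a "\<lambda>k. enn2real (SUP j. ennreal (norm (a j (j + k))))"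
    using assms(1) by (rule dominated_matrix_kernel)
  define S where "S = (\<Sum>\<^sub>\<infinity>k. enn2real (SUP j. ennreal (norm (a j (j + k)))))"
  obtain p C where p: "1 \<le> p" and C: "0 < C"
      "\<And>c. c \<in> lp_space p \<Longrightarrow> inverse C * lp_norm p c \<le> lp_norm p (matrix_op a c)"
    using assms(2) unfolding lp_stable_def by blast
  have "lp_norm p c \<le> C * lp_norm p (matrix_op a c)" if "c \<in> lp_space p" for c
    using C(1) C(2)[OF that] by (simp add: field_simps)
  then obtain K where K: "0 \<le> K"
      "\<And>c. c \<in> lp_space q \<Longrightarrow> lp_norm q c \<le> K * lp_norm q (matrix_op a c)"
    using lower_bound_transfer[OF p q C(1)] by blast
  have S: "lp_norm q (matrix_op a c) \<le> S * lp_norm q c" if "c \<in> lp_space q" for c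
    unfolding S_def using q that by (intro lp_norm_le lp_bound_matrix_op lp_bound_lp_norm)
  have "0 \<le> S" unfolding S_def by (rule infsum_nonneg) simp
  \<comment> \<open>One constant must serve both inequalities; adding 1 makes it positive even if
    \<open>K\<close> and \<open>S\<close> vanish.\<close>
  define D where "D = K + S + 1"
  have D: "0 < D" "K \<le> D" "S \<le> D" using K(1) \<open>0 \<le> S\<close> by (auto simp: D_def)
  have "inverse D * lp_norm q c \<le> lp_norm q (matrix_op a c) \<and>
      lp_norm q (matrix_op a c) \<le> D * lp_norm q c" if c: "c \<in> lp_space q" for c
  proof
    have "lp_norm q c \<le> D * lp_norm q (matrix_op a c)"
      using K(2)[OF c] mult_right_mono[OF D(2)] lp_norm_nonneg[OF q matrix_op_in_lp_space[OF q c]]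
      by fastforce
    then show "inverse D * lp_norm q c \<le> lp_norm q (matrix_op a c)"
      using D(1) by (simp add: field_simps)
    show "lp_norm q (matrix_op a c) \<le> D * lp_norm q c"
      using S[OF c] mult_right_mono[OF D(3) lp_norm_nonneg[OF q c]] by linarith
  qed
  then show "lp_stable q (matrix_op a)"
    unfolding lp_stable_def using D(1) q matrix_op_in_lp_space by blast
qed

end
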